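(* Let $X$ be an uncountable Polish space and let $Y$ be a Hausdorff topological space with $|Y|\ge 2$. Then the family of all quasi-continuous functions $f\colon X\to Y$ that are not Borel measurable has cardinality $\ge 2^{\mathfrak c}$. Moreover, if $2\le |Y|\le\mathfrak c$, then the cardinality of this family is equal to $2^{\mathfrak c}$.
   Context: $\mathfrak c=2^{\aleph_0}$ denotes the cardinality of the continuum. For topological spaces $X,Y$, a function $f\colon X\to Y$ is quasi-continuous if for each $x_0\in X$, each neighbourhood $W$ of $x_0$ and each neighbourhood $V$ of $f(x_0)$ there is a non-empty open set $W_0\subset W$ such that $f(W_0)\subset V$. A function is Borel measurable if preimages of open sets are Borel sets. *)

theory Defs
  imports "HOL-Analysis.Analysis" "HOL-Library.Equipollence"
begin

text \<open>A neighbourhood of \<open>x\<close> is any set with \<open>x\<close> in its interior; it need not be open.\<close>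

definition quasi_continuous :: "('a::topological_space \<Rightarrow> 'b::topological_space) \<Rightarrow> bool" where
  "quasi_continuous f \<longleftrightarrow>
    (\<forall>x W V. x \<in> interior W \<longrightarrow> f x \<in> interior V \<longrightarrow>
      (\<exists>W0. open W0 \<and> W0 \<noteq> {} \<and> W0 \<subseteq> W \<and> f ` W0 \<subseteq> V))"

text \<open>The library's Borel measurability asks for Borel preimages of all Borel sets;
  open sets suffice.\<close>

lemma borel_measurable_iff_open_vimage:
  fixes f :: "'a::topological_space \<Rightarrow> 'b::topological_space"
  shows "f \<in> borel_measurable borel \<longleftrightarrow> (\<forall>V. open V \<longrightarrow> f -` V \<in> sets borel)"
proof
  assume "f \<in> borel_measurable borel"
  then show "\<forall>V. open V \<longrightarrow> f -` V \<in> sets borel"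
    by (metis borel_open measurable_sets_borel)
next
  assume "\<forall>V. open V \<longrightarrow> f -` V \<in> sets borel"
  then show "f \<in> borel_measurable borel"
    by (intro borel_measurableI) simp
qed

end

theory Submission
  imports Defs
begin

text \<open>
  Let \<open>U\<close> and \<open>V\<close> be disjoint open sets and \<open>F = closure U \<inter> closure V\<close>. For \<open>A \<subseteq> F\<close>, the function
  that is \<open>a\<close> on \<open>A \<union> (closure U - closure V)\<close> and \<open>b\<close> elsewhere is quasi-continuous, since near each
  point of \<open>F\<close> both values are taken on open sets, and it is Borel only if \<open>A\<close> is. If \<open>F\<close> has
  cardinality \<open>\<cc>\<close>, then only \<open>\<cc>\<close> of its \<open>2\<^sup>\<cc>\<close> subsets are Borel. Such \<open>U\<close> and \<open>V\<close> arise as increasing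
  unions of open sets, built along with increasing finite sets of condensation points of the space
  so that the union of these finite sets is dense in itself and lies in \<open>closure U \<inter> closure V\<close>;
  the closure of this union is then perfect.
\<close>

section \<open>Cardinal arithmetic\<close>

unbundle cardinal_syntax

lemma lepoll_iff_card_of_ordLeq: "A \<lesssim> B \<longleftrightarrow> |A| \<le>o |B|"
  unfolding lepoll_def by (rule card_of_ordLeq)

lemma lesspoll_iff_card_of_ordLess: "A \<prec> B \<longleftrightarrow> |A| <o |B|"
proof -
  have "A \<prec> B \<longleftrightarrow> A \<lesssim> B \<and> \<not> B \<lesssim> A"
    unfolding lesspoll_def using lepoll_antisym eqpoll_imp_lepoll eqpoll_sym by blast
  then show ?thesis
    using not_ordLeq_iff_ordLess[OF card_of_Well_order card_of_Well_order] ordLess_imp_ordLeq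
    unfolding lepoll_iff_card_of_ordLeq by blast
qed

text \<open>If \<open>A - T\<close> were smaller than \<open>A\<close> as well, then
  \<open>A\<close> would be covered by two sets of smaller cardinality, which is impossible for
  infinite \<open>A\<close>.\<close>

lemma lepoll_Diff_lesspoll:
  assumes "infinite A" and "T \<prec> A"
  shows "A \<lesssim> A - T"
proof (rule ccontr)
  assume "\<not> A \<lesssim> A - T"
  then have "|A - T| <o |A|"
    using not_ordLeq_iff_ordLess[OF card_of_Well_order card_of_Well_order]
    unfolding lepoll_iff_card_of_ordLeq by blast
  then have "|(A - T) \<union> T| <o |A|"
    using assms card_of_Un_ordLess_infinite lesspoll_iff_card_of_ordLess by blast
  moreover have "|A| \<le>o |(A - T) \<union> T|"
    by (rule card_of_mono1) auto
  ultimately show False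
    using not_ordLess_ordLeq by blast
qed

lemma lepoll_Pow_mono:
  assumes "A \<lesssim> B"
  shows "Pow A \<lesssim> Pow B"
proof -
  obtain f where "inj_on f A" "f ` A \<subseteq> B"
    using assms unfolding lepoll_def by blast
  then have "inj_on (image f) (Pow A)" "image f ` Pow A \<subseteq> Pow B"
    by (auto simp: inj_on_image_Pow)
  then show ?thesis
    unfolding lepoll_def by blast
qed

text \<open>The disjoint sum codes two sets of naturals as one subset of a countable type, which
  \<open>to_nat\<close> carries back to the naturals.\<close>

lemma nat_sets_square_lepoll: "(UNIV :: nat set set) \<times> (UNIV :: nat set set) \<lesssim> (UNIV :: nat set set)"
proof -
  have Plus_inject: "A = C \<and> B = D" if "A <+> B = C <+> D" for A B C D :: "nat set"
  proof -
    have "Inl -` (A <+> B) = Inl -` (C <+> D)" "Inr -` (A <+> B) = Inr -` (C <+> D)"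
      using that by simp_all
    then show ?thesis
      by (auto simp: vimage_def)
  qed
  have "inj (\<lambda>(A, B). A <+> B :: (nat + nat) set)"
    by (auto simp: inj_def dest: Plus_inject)
  then have "inj (image to_nat \<circ> (\<lambda>(A, B). A <+> B :: (nat + nat) set))"
    by (intro inj_compose) (auto simp: inj_image_eq_iff inj_def)
  then show ?thesis
    unfolding lepoll_def by (metis UNIV_Times_UNIV subset_UNIV)
qed

section \<open>Cardinality of a countably generated sigma algebra\<close>

text \<open>Well-founded trees record how a set arises from generators by complements and countable
  unions. Counting them bounds the sigma algebra without a transfinite hierarchy.\<close>

datatype sigma_code = Gen_Code nat | Compl_Code sigma_code | Union_Code "nat \<Rightarrow> sigma_code"

primrec decode :: "'a set \<Rightarrow> (nat \<Rightarrow> 'a set) \<Rightarrow> sigma_code \<Rightarrow> 'a set" where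
  "decode \<Omega> G (Gen_Code n) = G n"
| "decode \<Omega> G (Compl_Code c) = \<Omega> - decode \<Omega> G c"
| "decode \<Omega> G (Union_Code c) = (\<Union>i. decode \<Omega> G (c i))"

text \<open>The label of the node of the code reached along a path; paths enter a complement by any number.\<close>

primrec label :: "sigma_code \<Rightarrow> nat list \<Rightarrow> nat" where
  "label (Gen_Code n) = (\<lambda>p. n + 2)"
| "label (Compl_Code c) = (\<lambda>p. case p of [] \<Rightarrow> 0 | _ # q \<Rightarrow> label c q)"
| "label (Union_Code c) = (\<lambda>p. case p of [] \<Rightarrow> 1 | i # q \<Rightarrow> label (c i) q)"

text \<open>At the empty path the label reveals the constructor: 0 for a complement, 1 for a union,
  and the shift by 2 keeps generators apart from both. The longer paths give the labels of the
  children, to which induction applies.\<close>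

lemma label_inject: "label c = label d \<Longrightarrow> c = d"
proof (induction c arbitrary: d)
  case (Gen_Code n)
  then show ?case
    by (cases d) (auto dest: fun_cong[of _ _ "[]"])
next
  case (Compl_Code c)
  then obtain d' where d: "d = Compl_Code d'"
    by (cases d) (auto dest: fun_cong[of _ _ "[]"])
  have "label c q = label d' q" for q
    using fun_cong[OF Compl_Code.prems, of "0 # q"] d by simp
  then show ?case
    using Compl_Code.IH d by blast
next
  case (Union_Code c)
  then obtain d' where d: "d = Union_Code d'"
    by (cases d) (auto dest: fun_cong[of _ _ "[]"])
  have "label (c i) q = label (d' i) q" for i q
    using fun_cong[OF Union_Code.prems, of "i # q"] d by simp
  then show ?case
    using Union_Code.IH d by blast
qed

text \<open>By \<open>label_inject\<close> a code is determined by the graph of its label function,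
  a subset of a countable type.\<close>

lemma sigma_code_lepoll: "(UNIV :: sigma_code set) \<lesssim> (UNIV :: nat set set)"
proof -
  let ?h = "\<lambda>c. range (\<lambda>p. to_nat (p, label c p))"
  have "inj ?h"
  proof (rule injI)
    fix c d
    assume eq: "?h c = ?h d"
    have "label c p = label d p" for p
    proof -
      have "to_nat (p, label c p) \<in> ?h d"
        using eq by blast
      then show ?thesis
        by auto
    qed
    then show "c = d"
      using label_inject by blast
  qed
  then show ?thesis
    unfolding lepoll_def by blast
qed

text \<open>Adding \<open>{}\<close> lets an enumeration exist even when there are no generators,
  and gives the empty set a code.\<close>

lemma sigma_sets_subset_range_decode:
  assumes "range G = insert {} \<G>"
  shows "sigma_sets \<Omega> \<G> \<subseteq> range (decode \<Omega> G)"
proof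
  fix A
  assume "A \<in> sigma_sets \<Omega> \<G>"
  then show "A \<in> range (decode \<Omega> G)"
  proof induction
    case (Basic A)
    then obtain n where "A = G n"
      using assms by blast
    then show ?case
      by (metis decode.simps(1) rangeI)
  next
    case Empty
    obtain n where "{} = G n"
      using assms by blast
    then show ?case
      by (metis decode.simps(1) rangeI)
  next
    case (Compl A)
    then show ?case
      by (metis (no_types) decode.simps(2) rangeE rangeI)
  next
    case (Union A)
    then have "\<forall>i. \<exists>c. A i = decode \<Omega> G c"
      by blast
    then obtain c where "\<And>i. A i = decode \<Omega> G (c i)"
      by metis
    then show ?case
      by (intro range_eqI[of _ _ "Union_Code c"]) simp
  qed
qed

lemma sigma_sets_lepoll:
  assumes "countable \<G>"
  shows "sigma_sets \<Omega> \<G> \<lesssim> (UNIV :: nat set set)"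
proof -
  obtain G :: "nat \<Rightarrow> 'a set" where "range G = insert {} \<G>"
    using assms by (metis countable_insert insert_not_empty range_from_nat_into)
  then show ?thesis
    using sigma_sets_subset_range_decode sigma_code_lepoll lepoll_trans subset_image_lepoll by metis
qed

lemma borel_lepoll:
  "sets (borel :: 'a::second_countable_topology measure) \<lesssim> (UNIV :: nat set set)"
proof -
  obtain B :: "'a set set" where B: "countable B" "topological_basis B"
    using ex_countable_basis by blast
  then have "sets (borel :: 'a measure) = sigma_sets UNIV B"
    by (simp add: borel_eq_countable_basis sets_measure_of)
  then show ?thesis
    using sigma_sets_lepoll[OF B(1), of UNIV] by metis
qed

text \<open>Singletons are closed in a T1 space, so points inject into the Borel sets.\<close>

lemma second_countable_lepoll:
  "(UNIV :: 'a::{second_countable_topology, t1_space} set) \<lesssim> (UNIV :: nat set set)"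
proof -
  have "(UNIV :: 'a set) \<lesssim> sets (borel :: 'a measure)"
    unfolding lepoll_def by (intro exI[of _ "\<lambda>x. {x}"]) auto
  then show ?thesis
    using borel_lepoll by (rule lepoll_trans)
qed

section \<open>A closed set approached by two disjoint open sets\<close>

text \<open>The set of condensation points works. Every other point lies in one of countably many
  countable basic open sets, so \<open>- P\<close> is countable, and removing it leaves uncountable
  sets uncountable.\<close>

lemma uncountable_imp_dense_in_itself:
  assumes "uncountable (UNIV :: 'a::second_countable_topology set)"
  obtains P :: "'a::second_countable_topology set" where "P \<noteq> {}" and "\<And>x. x \<in> P \<Longrightarrow> x islimpt P"
proof -
  define P where "P = {x::'a. \<forall>T. open T \<longrightarrow> x \<in> T \<longrightarrow> uncountable T}"
  obtain B :: "'a set set" where B: "countable B" "topological_basis B"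
    using ex_countable_basis by blast
  have "- P \<subseteq> \<Union>{T \<in> B. countable T}"
  proof
    fix x
    assume "x \<in> - P"
    then obtain T where T: "open T" "x \<in> T" "countable T"
      unfolding P_def by blast
    then obtain T' where "T' \<in> B" "x \<in> T'" "T' \<subseteq> T"
      using topological_basisE[OF B(2)] by metis
    then show "x \<in> \<Union>{T \<in> B. countable T}"
      using T(3) countable_subset by blast
  qed
  moreover have "countable (\<Union>T\<in>{T \<in> B. countable T}. T)"
    using B(1) by (intro countable_UN) (auto intro: countable_subset[of _ B])
  ultimately have co: "countable (- P)"
    by (simp add: countable_subset)
  have unc: "uncountable (T \<inter> P)" if "uncountable T" for T
  proof
    assume "countable (T \<inter> P)"
    then have "countable ((T \<inter> P) \<union> - P)"
      using co by simp
    moreover have "T \<subseteq> (T \<inter> P) \<union> - P"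
      by blast
    ultimately show False
      using that countable_subset by metis
  qed
  show thesis
  proof
    show "P \<noteq> {}"
      using unc[OF assms] by auto
    show "x islimpt P" if "x \<in> P" for x
    proof (rule islimptI)
      fix T
      assume "x \<in> T" "open T"
      then have "uncountable (T \<inter> P)"
        using that unc unfolding P_def by blast
      then have "\<not> T \<inter> P \<subseteq> {x}"
        using countable_subset[of "T \<inter> P" "{x}"] by auto
      then show "\<exists>y\<in>P. y \<in> T \<and> y \<noteq> x"
        by blast
    qed
  qed
qed

text \<open>The closure condition on the states \<open>(E, U, V)\<close> leaves room around \<open>E\<close> for later steps.\<close>

definition separated :: "'a::metric_space set \<Rightarrow> 'a set \<times> 'a set \<times> 'a set \<Rightarrow> bool" where
  "separated P = (\<lambda>(E, U, V). finite E \<and> E \<subseteq> P \<and> open U \<and> open V \<and> U \<inter> V = {}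
     \<and> closure U \<inter> E = {} \<and> closure V \<inter> E = {})"

definition extends :: "'a set \<times> 'a set \<times> 'a set \<Rightarrow> 'a set \<times> 'a set \<times> 'a set \<Rightarrow> bool" where
  "extends = (\<lambda>(E, U, V) (E', U', V'). E \<subseteq> E' \<and> U \<subseteq> U' \<and> V \<subseteq> V')"

text \<open>If this holds for every positive \<open>\<epsilon>\<close>, then \<open>e\<close> is a
  limit point of \<open>E\<close> and lies in the closures of \<open>U\<close> and
  \<open>V\<close>.\<close>

definition close :: "real \<Rightarrow> 'a::metric_space \<Rightarrow> 'a set \<times> 'a set \<times> 'a set \<Rightarrow> bool" where
  "close \<epsilon> e = (\<lambda>(E, U, V). ball e \<epsilon> \<inter> (E - {e}) \<noteq> {} \<and> ball e \<epsilon> \<inter> U \<noteq> {} \<and> ball e \<epsilon> \<inter> V \<noteq> {})"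

lemma extends_refl: "extends s s"
  unfolding extends_def by auto

lemma extends_trans: "extends s t \<Longrightarrow> extends t u \<Longrightarrow> extends s u"
  unfolding extends_def by auto

lemma close_extends: "close \<epsilon> e s \<Longrightarrow> extends s t \<Longrightarrow> close \<epsilon> e t"
  unfolding close_def extends_def by blast

lemma close_mono: "close \<delta> e s \<Longrightarrow> \<delta> \<le> \<epsilon> \<Longrightarrow> close \<epsilon> e s"
  using subset_ball[of \<delta> \<epsilon> e] unfolding close_def by (cases s) auto

lemma ex_cball_subset:
  assumes "open (S :: 'a::metric_space set)" and "x \<in> S"
  obtains \<delta> where "\<delta> > 0" and "cball x \<delta> \<subseteq> S"
  using assms open_contains_cball by blast

text \<open>Infinitely many points of \<open>P\<close> lie near \<open>e\<close>. Three new ones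
  suffice: one joins \<open>E\<close>, and small balls around the other two join \<open>U\<close>
  and \<open>V\<close>.\<close>

lemma separated_extend_point:
  assumes lim: "\<And>x. x \<in> P \<Longrightarrow> x islimpt P"
    and s: "separated P (E, U, V)" and "e \<in> E" and "\<epsilon> > 0"
  shows "\<exists>t. separated P t \<and> extends (E, U, V) t \<and> close \<epsilon> e t"
proof -
  have E: "finite E" "E \<subseteq> P" and UV: "open U" "open V" "U \<inter> V = {}"
    "closure U \<inter> E = {}" "closure V \<inter> E = {}"
    using s unfolding separated_def by auto
  \<comment> \<open>Since \<open>e\<close> avoids both closures, \<open>W\<close> is an open
    neighbourhood of \<open>e\<close> in which additions cannot meet the old \<open>U\<close> or
    \<open>V\<close>.\<close>
  define W where "W = ball e \<epsilon> - (closure U \<union> closure V)"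
  have W: "open W" "e \<in> W"
    using UV assms(3,4) unfolding W_def by auto
  have "\<exists>x. x \<in> P \<inter> W - D" if "finite D" for D
  proof -
    have "e islimpt P"
      using lim E(2) assms(3) by blast
    then have "infinite (W \<inter> P)"
      using W unfolding islimpt_eq_acc_point by blast
    then have "infinite (P \<inter> W - D)"
      unfolding Int_commute[of W]
      using that by (rule Diff_infinite_finite[rotated])
    then show ?thesis
      using infinite_imp_nonempty by blast
  qed
  note pick = this
  obtain p where p: "p \<in> P \<inter> W - E"
    using pick[OF E(1)] by blast
  obtain q where q: "q \<in> P \<inter> W - insert p E"
    using pick[of "insert p E"] E(1) by blast
  obtain r where r: "r \<in> P \<inter> W - insert q (insert p E)"
    using pick[of "insert q (insert p E)"] E(1) by blast
  \<comment> \<open>Closed balls are kept away from \<open>E\<close>, from \<open>p\<close> and from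
    each other, so that the closures of the open balls avoid the new finite set. Excluding
    \<open>r\<close> here leaves room for the second ball.\<close>
  have "open (W - insert r (insert p E))" "q \<in> W - insert r (insert p E)"
    using W(1) E(1) q r by (auto intro!: open_Diff finite_imp_closed)
  then obtain \<delta> where \<delta>: "\<delta> > 0" "cball q \<delta> \<subseteq> W - insert r (insert p E)"
    by (rule ex_cball_subset)
  have "open (W - (insert p E \<union> cball q \<delta>))" "r \<in> W - (insert p E \<union> cball q \<delta>)"
    using W(1) E(1) r \<delta>(2) by (auto intro!: open_Diff closed_Un closed_insert finite_imp_closed[of E])
  then obtain \<eta> where \<eta>: "\<eta> > 0" "cball r \<eta> \<subseteq> W - (insert p E \<union> cball q \<delta>)"
    by (rule ex_cball_subset)
  have cl: "closure (ball q \<delta>) \<subseteq> cball q \<delta>" "closure (ball r \<eta>) \<subseteq> cball r \<eta>"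
    by (intro closure_minimal ball_subset_cball closed_cball)+
  have sub: "ball q \<delta> \<subseteq> cball q \<delta>" "ball r \<eta> \<subseteq> cball r \<eta>"
    by auto
  have W_disj: "W \<inter> closure U = {}" "W \<inter> closure V = {}" "W \<subseteq> ball e \<epsilon>"
    unfolding W_def by auto
  have W_disj': "W \<inter> U = {}" "W \<inter> V = {}"
    using W_disj closure_subset by blast+
  have pos: "q \<in> ball q \<delta>" "r \<in> ball r \<eta>"
    using \<delta> \<eta> by auto
  let ?t = "(insert p E, U \<union> ball q \<delta>, V \<union> ball r \<eta>)"
  have "U \<inter> ball r \<eta> = {}" "ball q \<delta> \<inter> V = {}" "ball q \<delta> \<inter> ball r \<eta> = {}"
    using \<delta>(2) \<eta>(2) sub W_disj' by blast+
  moreover have "closure U \<inter> insert p E = {}" "closure V \<inter> insert p E = {}"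
    using UV p W_disj by auto
  moreover have "closure (ball q \<delta>) \<inter> insert p E = {}" "closure (ball r \<eta>) \<inter> insert p E = {}"
    using cl \<delta>(2) \<eta>(2) by blast+
  ultimately have "separated P ?t"
    using E UV p unfolding separated_def by (simp add: Int_Un_distrib2 Int_Un_distrib open_Un)
  moreover have "extends (E, U, V) ?t"
    unfolding extends_def by auto
  moreover have "close \<epsilon> e ?t"
    using p q r W_disj(3) pos assms(3) unfolding close_def by blast
  ultimately show ?thesis
    by blast
qed

text \<open>The points of \<open>D\<close> are treated one at a time; those already treated stay
  close by \<open>close_extends\<close>.\<close>

lemma separated_extend_finite:
  assumes lim: "\<And>x. x \<in> P \<Longrightarrow> x islimpt P"
    and s: "separated P s" and "\<epsilon> > 0" and "finite D" and "D \<subseteq> fst s"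
  shows "\<exists>t. separated P t \<and> extends s t \<and> (\<forall>e\<in>D. close \<epsilon> e t)"
  using assms(4,5)
proof (induction D)
  case empty
  then show ?case
    using s extends_refl by blast
next
  case (insert e D)
  then obtain t where t: "separated P t" "extends s t" "\<forall>e\<in>D. close \<epsilon> e t"
    by auto
  obtain E U V where t_eq: "t = (E, U, V)"
    by (cases t)
  have "e \<in> E"
    using insert.prems t(2) t_eq unfolding extends_def by auto
  then obtain u where "separated P u" "extends t u" "close \<epsilon> e u"
    using separated_extend_point[OF lim] t(1) assms(3) t_eq by metis
  then show ?case
    using t extends_trans close_extends by (metis insert_iff)
qed

text \<open>Stage \<open>n\<close> makes every current point close at scale \<open>1/(n+1)\<close>;
  \<open>E\<close>, \<open>U\<close> and \<open>V\<close> are the unions over all stages. Then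
  \<open>E\<close> has no isolated points, so its closure is a nonempty perfect set in a completely
  metrizable space and has at least \<cc> points.\<close>

lemma uncountable_imp_disjoint_open:
  assumes "uncountable (UNIV :: 'a::polish_space set)"
  obtains U V :: "'a::polish_space set" where "open U" "open V" "U \<inter> V = {}"
    and "(UNIV :: nat set set) \<lesssim> closure U \<inter> closure V"
proof -
  obtain P :: "'a set" where P: "P \<noteq> {}" and lim: "\<And>x. x \<in> P \<Longrightarrow> x islimpt P"
    using uncountable_imp_dense_in_itself[OF assms] by metis
  then obtain x0 where x0: "x0 \<in> P"
    by blast
  \<comment> \<open>Keeping \<open>x0\<close> in every state ensures that the final \<open>E\<close>
    is nonempty.\<close>
  have "\<exists>s. \<forall>n::nat. (separated P (s n) \<and> x0 \<in> fst (s n)) \<and>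
      (extends (s n) (s (Suc n)) \<and> (\<forall>e\<in>fst (s n). close (inverse (Suc n)) e (s (Suc n))))"
  proof (rule dependent_nat_choice)
    show "\<exists>s. separated P s \<and> x0 \<in> fst s"
      using x0 by (intro exI[of _ "({x0}, {}, {})"]) (auto simp: separated_def)
    fix s :: "'a set \<times> 'a set \<times> 'a set" and n :: nat
    assume s: "separated P s \<and> x0 \<in> fst s"
    then have "finite (fst s)"
      unfolding separated_def by auto
    then obtain t where t: "separated P t" "extends s t" "\<forall>e\<in>fst s. close (inverse (Suc n)) e t"
      using separated_extend_finite[OF lim, of s "inverse (Suc n)" "fst s"] s by auto
    moreover have "x0 \<in> fst t"
      using t(2) s unfolding extends_def by auto
    ultimately show "\<exists>t. (separated P t \<and> x0 \<in> fst t) \<and>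
        (extends s t \<and> (\<forall>e\<in>fst s. close (inverse (Suc n)) e t))"
      by blast
  qed
  then obtain s where s: "\<And>n. separated P (s n)" "\<And>n. x0 \<in> fst (s n)"
    "\<And>n. extends (s n) (s (Suc n))"
    "\<And>n e. e \<in> fst (s n) \<Longrightarrow> close (inverse (Suc n)) e (s (Suc n))"
    by metis
  define E U V where "E = (\<Union>n. fst (s n))" and "U = (\<Union>n. fst (snd (s n)))"
    and "V = (\<Union>n. snd (snd (s n)))"
  have mono: "extends (s m) (s n)" if "m \<le> n" for m n
    using that by (induction rule: dec_induct) (auto intro: extends_refl extends_trans s(3))
  have close: "close \<epsilon> e (E, U, V)" if e: "e \<in> E" and \<epsilon>: "\<epsilon> > 0" for e \<epsilon>
  proof -
    obtain m where m: "e \<in> fst (s m)"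
      using e unfolding E_def by blast
    obtain k where k: "inverse (Suc k) < \<epsilon>"
      using reals_Archimedean[OF \<epsilon>] by blast
    \<comment> \<open>This stage is late enough both for \<open>e\<close> to be present and for the
      scale to be below \<open>\<epsilon>\<close>.\<close>
    let ?n = "max m k"
    have "inverse (Suc ?n) \<le> inverse (Suc k)"
      by (intro le_imp_inverse_le) auto
    then have "inverse (Suc ?n) \<le> \<epsilon>"
      using k by linarith
    moreover have "e \<in> fst (s ?n)"
      using m mono[of m ?n] unfolding extends_def by auto
    then have "close (inverse (Suc ?n)) e (s (Suc ?n))"
      by (rule s(4))
    ultimately have "close \<epsilon> e (s (Suc ?n))"
      using close_mono by blast
    moreover have "extends (s (Suc ?n)) (E, U, V)"
      unfolding extends_def E_def U_def V_def by (auto split: prod.split simp: split_beta)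
    ultimately show ?thesis
      by (rule close_extends)
  qed
  have E: "E \<noteq> {}"
    using s(2) unfolding E_def by auto
  have near: "\<exists>y\<in>E. y \<noteq> e \<and> dist y e < \<epsilon>" "\<exists>y\<in>U. dist y e < \<epsilon>" "\<exists>y\<in>V. dist y e < \<epsilon>"
    if "e \<in> E" "\<epsilon> > 0" for e \<epsilon>
    using close[OF that] unfolding close_def by (auto simp: dist_commute)
  then have "e islimpt E" if "e \<in> E" for e
    using that unfolding islimpt_approachable by blast
  then have "x islimpt E" if "x \<in> closure E" for x
    using that unfolding closure_def by blast
  then have islimpt: "x islimpt closure E" if "x \<in> closure E" for x
    using that islimpt_subset closure_subset by blast
  have perfect: "euclidean derived_set_of closure E = closure E"
  proof -
    have "euclidean derived_set_of S = {x. x islimpt S}" for S :: "'a set"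
      by (auto simp: derived_set_of_def islimpt_def)
    then show ?thesis
      using islimpt closed_limpt[of "closure E"] by auto
  qed
  have "E \<subseteq> closure U \<inter> closure V"
    using near(2,3) unfolding subset_iff Int_iff closure_approachable by blast
  then have sub: "closure E \<subseteq> closure U \<inter> closure V"
    by (intro closure_minimal) auto
  show thesis
  proof
    show "open U" "open V"
      using s(1) unfolding U_def V_def separated_def by (auto simp: split_beta)
    show "U \<inter> V = {}"
    proof -
      \<comment> \<open>The stages may differ, but both sets lie in those of stage
        \<open>max m n\<close>, which are disjoint.\<close>
      have "fst (snd (s m)) \<inter> snd (snd (s n)) = {}" for m n
      proof -
        have "fst (snd (s m)) \<subseteq> fst (snd (s (max m n)))" "snd (snd (s n)) \<subseteq> snd (snd (s (max m n)))"
          using mono[of m "max m n"] mono[of n "max m n"] unfolding extends_def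
          by (auto simp: split_beta)
        moreover have "fst (snd (s (max m n))) \<inter> snd (snd (s (max m n))) = {}"
          using s(1) unfolding separated_def by (auto simp: split_beta)
        ultimately show ?thesis
          by blast
      qed
      then show ?thesis
        unfolding U_def V_def by blast
    qed
    have "(UNIV :: real set) \<lesssim> closure E"
      using perfect E by (intro lepoll_perfect_set[of euclidean]) (auto simp: completely_metrizable_space_euclidean)
    then show "(UNIV :: nat set set) \<lesssim> closure U \<inter> closure V"
      using nat_sets_eqpoll_reals sub lepoll_trans lepoll_trans1 subset_imp_lepoll by meson
  qed
qed

section \<open>Quasi-continuous functions with two values\<close>

text \<open>The value \<open>f x\<close> lies in each of its neighbourhoods, so taking exactly this
  value on an open set settles all of them at once; the topology of the codomain does not
  enter.\<close>

lemma quasi_continuousI: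
  assumes "\<And>x W. open W \<Longrightarrow> x \<in> W \<Longrightarrow>
    \<exists>W0. open W0 \<and> W0 \<noteq> {} \<and> W0 \<subseteq> W \<and> (\<forall>y\<in>W0. f y = f x)"
  shows "quasi_continuous f"
  unfolding quasi_continuous_def
proof (intro allI impI)
  fix x W V
  assume x: "x \<in> interior W" "f x \<in> interior V"
  then obtain W0 where "open W0" "W0 \<noteq> {}" "W0 \<subseteq> interior W" "\<forall>y\<in>W0. f y = f x"
    using assms[of "interior W" x] by auto
  then show "\<exists>W0. open W0 \<and> W0 \<noteq> {} \<and> W0 \<subseteq> W \<and> f ` W0 \<subseteq> V"
    using x interior_subset by (intro exI[of _ W0]) (auto, metis interior_subset subsetD)
qed

text \<open>For \<open>A\<close> inside both closures, \<open>A\<close> only decides the values on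
  \<open>closure U \<inter> closure V\<close>; the value is \<open>a\<close> on the rest of
  \<open>closure U\<close> and \<open>b\<close> off \<open>closure U\<close>.\<close>

definition two_valued :: "'a::topological_space set \<Rightarrow> 'a set \<Rightarrow> 'b \<Rightarrow> 'b \<Rightarrow> 'a set \<Rightarrow> 'a \<Rightarrow> 'b" where
  "two_valued U V a b A x = (if x \<in> A \<union> (closure U - closure V) then a else b)"

text \<open>A point assigned \<open>a\<close> lies in \<open>closure U\<close>, so its
  neighbourhoods meet \<open>U\<close>, where the value is \<open>a\<close>. A point assigned
  \<open>b\<close> lies outside \<open>closure U\<close> or in \<open>closure V\<close>, so its
  neighbourhoods meet the open set \<open>- closure U \<union> V\<close>, where the value is
  \<open>b\<close>.\<close>

lemma quasi_continuous_two_valued: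
  fixes U V :: "'a::topological_space set"
  assumes UV: "open U" "open V" "U \<inter> V = {}" and A: "A \<subseteq> closure U \<inter> closure V"
  shows "quasi_continuous (two_valued U V a b A)"
proof (rule quasi_continuousI)
  fix x :: 'a and W
  assume W: "open W" "x \<in> W"
  have U: "two_valued U V a b A y = a" if "y \<in> U" for y
  proof -
    have "U \<inter> closure V = {}"
      using UV open_Int_closure_eq_empty[of U V] by blast
    then have "y \<in> closure U - closure V"
      using that closure_subset by blast
    then show ?thesis
      unfolding two_valued_def by simp
  qed
  have V: "two_valued U V a b A y = b" if "y \<in> - closure U \<union> V" for y
  proof -
    have "V \<inter> closure U = {}"
      using UV open_Int_closure_eq_empty[of V U] by blast
    then show ?thesis
      using that A unfolding two_valued_def by auto
  qed
  show "\<exists>W0. open W0 \<and> W0 \<noteq> {} \<and> W0 \<subseteq> W \<and>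
      (\<forall>y\<in>W0. two_valued U V a b A y = two_valued U V a b A x)"
  proof (cases "x \<in> A \<union> (closure U - closure V)")
    case True
    then have "x \<in> closure U"
      using A by auto
    then have "W \<inter> U \<noteq> {}"
      using W open_Int_closure_eq_empty[of W U] by blast
    moreover have "two_valued U V a b A x = a"
      using True unfolding two_valued_def by simp
    ultimately show ?thesis
      using W(1) UV(1) U by (intro exI[of _ "W \<inter> U"]) auto
  next
    case False
    then have "x \<in> - closure U \<union> closure V"
      by auto
    then have "W \<inter> (- closure U \<union> V) \<noteq> {}"
      using W open_Int_closure_eq_empty[of W V] by blast
    moreover have "two_valued U V a b A x = b"
      using False unfolding two_valued_def by auto
    moreover have "open (W \<inter> (- closure U \<union> V))"
      using W(1) UV(2) by (intro open_Int open_Un) auto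
    ultimately show ?thesis
      using V by (intro exI[of _ "W \<inter> (- closure U \<union> V)"]) auto
  qed
qed

lemma two_valued_eq_iff: "a \<noteq> b \<Longrightarrow> two_valued U V a b A x = a \<longleftrightarrow> x \<in> A \<union> (closure U - closure V)"
  unfolding two_valued_def by auto

lemma inj_on_two_valued:
  assumes "a \<noteq> b"
  shows "inj_on (two_valued U V a b) (Pow (closure U \<inter> closure V))"
proof (rule inj_onI)
  fix A B
  assume AB: "A \<in> Pow (closure U \<inter> closure V)" "B \<in> Pow (closure U \<inter> closure V)"
    and "two_valued U V a b A = two_valued U V a b B"
  then have "A \<union> (closure U - closure V) = B \<union> (closure U - closure V)"
    using two_valued_eq_iff[OF assms] by (metis (no_types) subset_antisym subsetI)
  then show "A = B"
    using AB by blast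
qed

text \<open>The preimage of the closed set \<open>{a}\<close> is Borel, and intersecting it with the
  closed set \<open>closure U \<inter> closure V\<close> recovers \<open>A\<close>.\<close>

lemma borel_of_two_valued:
  fixes a b :: "'b::t1_space"
  assumes "a \<noteq> b" and A: "A \<subseteq> closure U \<inter> closure V"
    and f: "two_valued U V a b A \<in> borel_measurable borel"
  shows "A \<in> sets borel"
proof -
  have "two_valued U V a b A -` {a} \<in> sets borel"
    using measurable_sets_borel[OF f, of "{a}"] by simp
  also have "two_valued U V a b A -` {a} = A \<union> (closure U - closure V)"
    using two_valued_eq_iff[OF assms(1)] by auto
  finally have "(A \<union> (closure U - closure V)) \<inter> (closure U \<inter> closure V) \<in> sets borel"
    by (intro sets.Int) auto
  also have "(A \<union> (closure U - closure V)) \<inter> (closure U \<inter> closure V) = A"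
    using A by blast
  finally show ?thesis .
qed

text \<open>A function is determined by its graph, a subset of a product of cardinality at most
  \<cc>.\<close>

lemma functions_lepoll:
  assumes "(UNIV :: 'a set) \<lesssim> (UNIV :: nat set set)" and "(UNIV :: 'b set) \<lesssim> (UNIV :: nat set set)"
  shows "(UNIV :: ('a \<Rightarrow> 'b) set) \<lesssim> (UNIV :: nat set set set)"
proof -
  have "inj (\<lambda>f :: 'a \<Rightarrow> 'b. {(x, y). f x = y})"
    by (auto simp: inj_def set_eq_iff)
  then have "(UNIV :: ('a \<Rightarrow> 'b) set) \<lesssim> Pow (UNIV :: ('a \<times> 'b) set)"
    unfolding lepoll_def by blast
  also have "(UNIV :: ('a \<times> 'b) set) \<lesssim> (UNIV :: nat set set) \<times> (UNIV :: nat set set)"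
    using times_lepoll_mono[OF assms] by simp
  then have "(UNIV :: ('a \<times> 'b) set) \<lesssim> (UNIV :: nat set set)"
    using nat_sets_square_lepoll lepoll_trans by blast
  then have "Pow (UNIV :: ('a \<times> 'b) set) \<lesssim> Pow (UNIV :: nat set set)"
    by (rule lepoll_Pow_mono)
  finally show ?thesis
    by simp
qed

text \<open>The cardinals \<cc> and \<open>2\<^sup>\<cc>\<close> are represented by the types
  \<open>nat set\<close> and \<open>nat set set\<close>.\<close>

theorem corollary18:
  assumes "uncountable (UNIV :: 'a::polish_space set)"
    and "{..<2::nat} \<lesssim> (UNIV :: 'b::t2_space set)"
  shows "(UNIV :: nat set set set) \<lesssim>
           {f :: 'a \<Rightarrow> 'b. quasi_continuous f \<and> f \<notin> borel_measurable borel}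
       \<and> ((UNIV :: 'b set) \<lesssim> (UNIV :: nat set set) \<longrightarrow>
           {f :: 'a \<Rightarrow> 'b. quasi_continuous f \<and> f \<notin> borel_measurable borel}
             \<approx> (UNIV :: nat set set set))"
proof -
  let ?Q = "{f :: 'a \<Rightarrow> 'b. quasi_continuous f \<and> f \<notin> borel_measurable borel}"
  obtain g :: "nat \<Rightarrow> 'b" where "inj_on g {..<2}"
    using assms(2) unfolding lepoll_def by blast
  then have ab: "g 0 \<noteq> g 1"
    by (auto dest: inj_onD)
  obtain U V :: "'a set" where UV: "open U" "open V" "U \<inter> V = {}"
    and F: "(UNIV :: nat set set) \<lesssim> closure U \<inter> closure V"
    using uncountable_imp_disjoint_open[OF assms(1)] .
  let ?F = "closure U \<inter> closure V"
  have PowF: "(UNIV :: nat set set set) \<lesssim> Pow ?F"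
    using lepoll_Pow_mono[OF F] by simp
  \<comment> \<open>There are at most \<cc> Borel sets and at least \<cc> points in
    \<open>?F\<close>, so Cantor's theorem makes the inequality strict.\<close>
  have "sets (borel :: 'a measure) \<prec> Pow ?F"
    using lesspoll_trans1[OF lepoll_trans[OF borel_lepoll F] lesspoll_Pow_self] .
  then have "Pow ?F \<inter> sets borel \<prec> Pow ?F"
    using lesspoll_trans1 subset_imp_lepoll by (metis inf_le2)
  moreover have "infinite (Pow ?F)"
    using PowF lepoll_trans infinite_UNIV_nat
    by (metis Finite_Set.finite_set finite_lepoll_infinite infinite_le_lepoll lepoll_trans)
  \<comment> \<open>Deleting the fewer Borel subsets does not lower the cardinality.\<close>
  ultimately have "Pow ?F \<lesssim> Pow ?F - Pow ?F \<inter> sets borel"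
    by (intro lepoll_Diff_lesspoll)
  also have "Pow ?F - Pow ?F \<inter> sets borel \<lesssim> ?Q"
    unfolding lepoll_def
  proof (intro exI conjI)
    show "inj_on (two_valued U V (g 0) (g 1)) (Pow ?F - Pow ?F \<inter> sets borel)"
      using inj_on_two_valued[OF ab] by (rule inj_on_subset) auto
    show "two_valued U V (g 0) (g 1) ` (Pow ?F - Pow ?F \<inter> sets borel) \<subseteq> ?Q"
      using quasi_continuous_two_valued[OF UV] borel_of_two_valued[OF ab, of _ U V] by auto
  qed
  finally have lower: "(UNIV :: nat set set set) \<lesssim> ?Q"
    using PowF lepoll_trans by blast
  moreover have "?Q \<lesssim> (UNIV :: nat set set set)" if "(UNIV :: 'b set) \<lesssim> (UNIV :: nat set set)"
    using functions_lepoll[OF second_countable_lepoll that] subset_imp_lepoll[of ?Q UNIV] lepoll_trans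
    by blast
  ultimately show ?thesis
    using lepoll_antisym by blast
qed

end
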